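(* Consider the stochastic energy exchange model with transition kernel $P^t$ and the set $\mathfrak{C}$ described in the context. For any $t>0$ there exists a constant $\kappa>0$ such that $$P^t(\mathbf{E},\cdot)\ge\kappa\,U_{\mathfrak{C}}(\cdot)\quad\text{for all }\mathbf{E}\in\mathfrak{C},$$ where $U_{\mathfrak{C}}$ is the uniform probability measure on $\mathfrak{C}$.
   Context: Fix $N\ge1$, $T_L,T_R>0$, a sufficiently large $K$ ($K\gg T_L,T_R$) and $R(a,b)=\min\{K,\sqrt{\min(a,b)}\}$. The stochastic energy exchange model is the Markov jump process $\mathbf{E}_t=(E_1(t),\dots,E_N(t))$ on $\mathbb{R}^N_+$: for $i=1,\dots,N-1$ a clock of rate $R(E_i,E_{i+1})$ on sites $i,i+1$; when it rings $(E_i,E_{i+1})\mapsto(p(E_i+E_{i+1}),(1-p)(E_i+E_{i+1}))$, $p$ uniform on $(0,1)$; a clock of rate $R(T_L,E_1)$ (resp. $R(E_N,T_R)$) with $E_1\mapsto p(E_1+X_L)$ (resp. $E_N\mapsto p(E_N+X_R)$), $X_L,X_R$ exponential with means $T_L,T_R$; all independent. $P^t$ is its transition kernel. Let $W(\mathbf{E})=\sum_iE_i$, $a_m=1-\frac{2^{m-1}-1}{2^N-1}$, and for small $\eta>0$, $V(\mathbf{E})=\sum_{m=1}^N\sum_{k=1}^{N-m+1}\big(\sum_{j=0}^{m-1}E_{k+j}\big)^{a_m\eta-1}$. $M_0,M_1>1$ are the constants fixed in the paper (for small fixed $\eta,h>0$: $M_0$ is such that $P^hV-V\le-c_0V^{\alpha}$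 on $\{V>M_0\}$, and $M_1$ is such that the induced chain on $\{V\le M_0\}$ contracts $W$ on $\{W>M_1\}$). $\mathfrak{C}=\{\mathbf{E}:V(\mathbf{E})\le M_0,\ W(\mathbf{E})\le M_1\}$. *)

theory Defs
  imports "HOL-Probability.Probability"
begin

text \<open>States E = (E_1,...,E_N) are functions nat => real, extensional on {1..N}.
  The state space measure is the N-fold product of Lebesgue measure.\<close>

type_synonym state = "nat \<Rightarrow> real"

definition state_space :: "nat \<Rightarrow> state measure" where
  "state_space N = PiM {1..N} (\<lambda>_. lborel)"

definition rateR :: "real \<Rightarrow> real \<Rightarrow> real \<Rightarrow> real" where
  "rateR K a b = min K (sqrt (min a b))"

definition unif01 :: "real measure" where
  "unif01 = uniform_measure lborel {0<..<1}"

definition expo_mean :: "real \<Rightarrow> real measure" where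
  "expo_mean T = density lborel (exponential_density (1 / T))"

text \<open>Clocks indexed by j in {0..N}: j = 0 is the left bath, j = N the right bath,
  1 <= j <= N-1 the exchange between sites j and j+1.\<close>
definition clock_rate :: "nat \<Rightarrow> real \<Rightarrow> real \<Rightarrow> real \<Rightarrow> state \<Rightarrow> nat \<Rightarrow> real" where
  "clock_rate N K TL TR E j =
     (if j = 0 then rateR K TL (E 1)
      else if j = N then rateR K (E N) TR
      else rateR K (E j) (E (Suc j)))"

definition jump_kernel :: "nat \<Rightarrow> real \<Rightarrow> real \<Rightarrow> state \<Rightarrow> nat \<Rightarrow> state measure" where
  "jump_kernel N TL TR E j =
     (if j = 0 then
        distr (unif01 \<Otimes>\<^sub>M expo_mean TL) (state_space N)
          (\<lambda>(p, x). E(1 := p * (E 1 + x)))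
      else if j = N then
        distr (unif01 \<Otimes>\<^sub>M expo_mean TR) (state_space N)
          (\<lambda>(p, x). E(N := p * (E N + x)))
      else
        distr unif01 (state_space N)
          (\<lambda>p. E(j := p * (E j + E (Suc j)), Suc j := (1 - p) * (E j + E (Suc j)))))"

text \<open>Uniformization constant: total rate is at most (N+1) K.\<close>
definition unif_rate :: "nat \<Rightarrow> real \<Rightarrow> real" where
  "unif_rate N K = real (N + 1) * K"

text \<open>Uniformized one-step kernel: clock j fires with probability rate_j / Lambda,
  otherwise (index N+1) the state is unchanged.\<close>
definition step_weight :: "nat \<Rightarrow> real \<Rightarrow> real \<Rightarrow> real \<Rightarrow> state \<Rightarrow> nat \<Rightarrow> real" where
  "step_weight N K TL TR E j =
     (if j \<le> N then clock_rate N K TL TR E j / unif_rate N K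
      else 1 - (\<Sum>i\<le>N. clock_rate N K TL TR E i) / unif_rate N K)"

definition step_kernel :: "nat \<Rightarrow> real \<Rightarrow> real \<Rightarrow> real \<Rightarrow> state \<Rightarrow> state measure" where
  "step_kernel N K TL TR E =
     bind (point_measure {0..N+1} (\<lambda>j. ennreal (step_weight N K TL TR E j)))
          (\<lambda>j. if j \<le> N then jump_kernel N TL TR E j else return (state_space N) E)"

primrec step_iter :: "nat \<Rightarrow> real \<Rightarrow> real \<Rightarrow> real \<Rightarrow> nat \<Rightarrow> state \<Rightarrow> state measure" where
  "step_iter N K TL TR 0 E = return (state_space N) E"
| "step_iter N K TL TR (Suc n) E = bind (step_iter N K TL TR n E) (step_kernel N K TL TR)"

text \<open>Transition kernel P^t of the jump process (uniformization):
  P^t(E,.) = sum_n Poisson(Lambda t){n} Q^n(E,.).\<close>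
definition transition :: "nat \<Rightarrow> real \<Rightarrow> real \<Rightarrow> real \<Rightarrow> real \<Rightarrow> state \<Rightarrow> state measure" where
  "transition N K TL TR t E =
     bind (measure_pmf (poisson_pmf (unif_rate N K * t))) (\<lambda>n. step_iter N K TL TR n E)"

definition W_fun :: "nat \<Rightarrow> state \<Rightarrow> real" where
  "W_fun N E = (\<Sum>i=1..N. E i)"

definition a_coef :: "nat \<Rightarrow> nat \<Rightarrow> real" where
  "a_coef N m = 1 - (2 ^ (m - 1) - 1) / (2 ^ N - 1)"

definition V_fun :: "nat \<Rightarrow> real \<Rightarrow> state \<Rightarrow> real" where
  "V_fun N \<eta> E = (\<Sum>m=1..N. \<Sum>k=1..N-m+1. (\<Sum>j=0..m-1. E (k + j)) powr (a_coef N m * \<eta> - 1))"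

text \<open>The set C (energies strictly positive, so that V is finite).\<close>
definition C_set :: "nat \<Rightarrow> real \<Rightarrow> real \<Rightarrow> real \<Rightarrow> state set" where
  "C_set N \<eta> M0 M1 = {E \<in> space (state_space N). (\<forall>i\<in>{1..N}. 0 < E i) \<and>
       V_fun N \<eta> E \<le> M0 \<and> W_fun N E \<le> M1}"

end

theory Submission
  imports Defs
begin

text \<open>On C every energy lies in an interval (lo, hi) with 0 < lo, because V contains the terms
  E_k^(\<eta> - 1). From such a state let the N + 1 clocks 0, 1, ..., N fire once each, in this
  order. The left bath gives E_1 a density on a window of large energies. When clock k then fires,
  the pair (E_k, p) is mapped to the new (E_k, E_(k+1)) with Jacobian E_k + E_(k+1), so the
  joint law has a density bounded below where E_k is in (lo, hi) and E_(k+1) is in a slightly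
  smaller window: the window has to be high enough that E_k + E_(k+1) exceeds every possible old
  value of E_(k+1). The last clock, the right bath, brings E_N back to (lo, hi). Hence the
  (N+1)-step uniformized kernel dominates a multiple of Lebesgue measure on the box.\<close>

section \<open>Image measures and binds only see the points that are mapped into the target
  space\<close>

text \<open>A point that leaves \<open>space S\<close> lies in no preimage of a measurable set, so
  both set functions agree on the sigma-algebra. Comparing them there, below
  \<open>measure_of\<close>, avoids any measurability assumption on \<open>f\<close>.\<close>

lemma distr_restrict_space:
  assumes G: "G \<in> sets M"
    and off: "\<And>x. x \<in> space M \<Longrightarrow> x \<notin> G \<Longrightarrow> f x \<notin> space S"
  shows "distr M S f = distr (restrict_space M G) S f"
  unfolding distr_def
proof (rule measure_of_eq)
  show "sets S \<subseteq> Pow (space S)"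
    by (rule sets.space_closed)
  fix A assume "A \<in> sigma_sets (space S) (sets S)"
  then have "A \<subseteq> space S"
    using sets.sets_into_space by (simp add: sets.sigma_sets_eq)
  moreover have "G \<subseteq> space M"
    using G by (rule sets.sets_into_space)
  ultimately have "f -` A \<inter> space M = f -` A \<inter> space (restrict_space M G)"
    using off by (auto simp: space_restrict_space)
  then show "emeasure M (f -` A \<inter> space M)
      = emeasure (restrict_space M G) (f -` A \<inter> space (restrict_space M G))"
    using G by (subst emeasure_restrict_space) (auto simp: space_restrict_space)
qed

text \<open>\<open>bind\<close> is a \<open>join\<close> of a \<open>distr\<close> into a
  sub-probability algebra, and a kernel value that is no sub-probability lies outside the space of
  that algebra. This is how states with a defective step kernel are discarded later.\<close>

lemma bind_restrict_space:
  assumes G: "G \<in> sets M" "G \<noteq> {}"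
    and sets_f: "\<And>x. x \<in> space M \<Longrightarrow> sets (f x) = sets S"
    and off: "\<And>x. x \<in> space M \<Longrightarrow> x \<notin> G \<Longrightarrow> \<not> subprob_space (f x)"
  shows "bind M f = bind (restrict_space M G) f"
proof -
  have GM: "G \<subseteq> space M"
    using G(1) by (rule sets.sets_into_space)
  then have ne: "space M \<noteq> {}" "space (restrict_space M G) \<noteq> {}"
    using G(2) by (auto simp: space_restrict_space)
  \<comment> \<open>\<open>bind\<close> reads its target algebra off an arbitrarily chosen point of
    the space; the choices for \<open>M\<close> and for its restriction may differ but give the same
    algebra.\<close>
  have some: "subprob_algebra (f (SOME x. x \<in> space X)) = subprob_algebra S"
    if "space X \<noteq> {}" "space X \<subseteq> space M" for X :: "'a measure"
    using that by (intro subprob_algebra_cong sets_f) (meson someI_ex subsetD ex_in_conv)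
  have "space (restrict_space M G) \<subseteq> space M"
    by (simp add: space_restrict_space)
  then show ?thesis
    unfolding bind_def
    using ne some[OF ne(1)] some[OF ne(2)]
      distr_restrict_space[OF G(1), of f "subprob_algebra S"] off
    by (simp add: space_subprob_algebra)
qed

section \<open>Density bounds for a single exchange and a single bath jump\<close>

text \<open>Substitution \<open>w = p * s\<close>: a uniform fraction of a total energy
  \<open>s\<close> has density \<open>1 / s\<close> on \<open>(0, s)\<close>.\<close>

lemma nn_integral_unit_interval_scale:
  fixes g :: "real \<Rightarrow> ennreal"
  assumes [measurable]: "g \<in> borel_measurable borel" and s: "0 < s"
  shows "(\<integral>\<^sup>+p. g (p * s) * indicator {0<..<1} p \<partial>lborel)
    = ennreal (1 / s) * (\<integral>\<^sup>+w. g w * indicator {0<..<s} w \<partial>lborel)"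
proof -
  have "(\<integral>\<^sup>+w. g w * indicator {0<..<s} w \<partial>lborel)
      = ennreal s * (\<integral>\<^sup>+p. g (p * s) * indicator {0<..<s} (p * s) \<partial>lborel)"
    using s by (subst nn_integral_real_affine[where c = s and t = 0]) (auto simp: mult.commute)
  also have "(\<lambda>p. g (p * s) * indicator {0<..<s} (p * s)) = (\<lambda>p. g (p * s) * indicator {0<..<1} p)"
    using s by (auto simp: fun_eq_iff indicator_def zero_less_mult_iff)
  finally show ?thesis
    using s by (simp add: mult.assoc[symmetric] ennreal_mult'[symmetric])
qed

lemma nn_integral_unif01:
  assumes [measurable]: "g \<in> borel_measurable borel"
  shows "(\<integral>\<^sup>+p. g p \<partial>unif01) = (\<integral>\<^sup>+p. g p * indicator {0<..<1} p \<partial>lborel)"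
  unfolding unif01_def by (subst nn_integral_uniform_measure) (auto simp: divide_ennreal_def)

text \<open>Here \<open>z\<close> and \<open>b\<close> are the old energies of the two sites, and
  only \<open>z\<close> has a density. The map from \<open>(z, p)\<close> to the new energies
  \<open>(w, v)\<close> has Jacobian \<open>z + b\<close>, at most \<open>u + hi\<close>, and is
  inverted through \<open>z = w + v - b\<close>.\<close>

lemma nn_integral_exchange_ge:
  fixes g :: "real \<Rightarrow> real \<Rightarrow> ennreal"
  assumes [measurable]: "case_prod g \<in> borel_measurable (borel \<Otimes>\<^sub>M borel)"
    and lo: "0 < lo" and b: "lo < b" "b < hi" and l: "0 \<le> l"
  shows "(\<integral>\<^sup>+z. (\<integral>\<^sup>+p. g (p * (z + b)) ((1 - p) * (z + b)) * indicator {0<..<1} p \<partial>lborel)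
            * indicator {l<..<u} z \<partial>lborel)
    \<ge> ennreal (1 / (u + hi)) *
        (\<integral>\<^sup>+w. (\<integral>\<^sup>+v. g w v * indicator {l + hi<..<u - hi} v \<partial>lborel)
            * indicator {lo<..<hi} w \<partial>lborel)" (is "?L \<ge> _ * ?R")
proof -
  have gm[measurable (raw)]: "(\<lambda>x. g (h x) (k x)) \<in> borel_measurable M"
    if [measurable]: "h \<in> borel_measurable M" "k \<in> borel_measurable M" for h k and M :: "'z measure"
  proof -
    have "(\<lambda>x. case_prod g (h x, k x)) \<in> borel_measurable M" by measurable
    then show ?thesis by simp
  qed
  \<comment> \<open>The integrand in the mixed variables \<open>z\<close> and \<open>w\<close>, to
    be integrated in both orders: for fixed \<open>w\<close> the shift \<open>z = v + w - b\<close>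
    leads to the right-hand side, for fixed \<open>z\<close> the scaling
    \<open>w = p * (z + b)\<close> leads to the left-hand side.\<close>
  let ?F = "\<lambda>z w. if 0 < w \<and> w < z + b \<and> l < z \<and> z < u then g w (z + b - w) else 0"
  have "?R \<le> (\<integral>\<^sup>+w. (\<integral>\<^sup>+z. ?F z w \<partial>lborel) \<partial>lborel)"
  proof (rule nn_integral_mono)
    fix w :: real
    have "(\<lambda>z. ?F z w) \<in> borel_measurable borel"
      by measurable
    then have "(\<integral>\<^sup>+z. ?F z w \<partial>lborel)
        = (\<integral>\<^sup>+v. (if 0 < w \<and> 0 < v \<and> l < w + v - b \<and> w + v - b < u then g w v else 0) \<partial>lborel)"
      by (subst nn_integral_real_affine[where c = 1 and t = "w - b"])
        (auto simp: algebra_simps intro!: nn_integral_cong arg_cong[of _ _ "g w"])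
    \<comment> \<open>Since \<open>w\<close> and \<open>b\<close> both lie in
      \<open>(lo, hi)\<close>, they differ by less than \<open>hi\<close>. Shrinking the window of
      \<open>v\<close> by \<open>hi\<close> at each end therefore keeps \<open>w + v - b\<close> in
      \<open>(l, u)\<close>.\<close>
    also have "\<dots> \<ge> (\<integral>\<^sup>+v. g w v * indicator {l + hi<..<u - hi} v * indicator {lo<..<hi} w \<partial>lborel)"
      using lo b l by (intro nn_integral_mono) (auto simp: indicator_def)
    finally show "(\<integral>\<^sup>+v. g w v * indicator {l + hi<..<u - hi} v \<partial>lborel) * indicator {lo<..<hi} w
        \<le> (\<integral>\<^sup>+z. ?F z w \<partial>lborel)"
      by (subst (asm) nn_integral_multc) auto
  qed
  also have "\<dots> = (\<integral>\<^sup>+z. (\<integral>\<^sup>+w. ?F z w \<partial>lborel) \<partial>lborel)"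
    by (rule lborel_pair.Fubini') measurable
  finally have "ennreal (1 / (u + hi)) * ?R
      \<le> ennreal (1 / (u + hi)) * (\<integral>\<^sup>+z. (\<integral>\<^sup>+w. ?F z w \<partial>lborel) \<partial>lborel)"
    by (intro mult_left_mono) auto
  also have "\<dots> = (\<integral>\<^sup>+z. ennreal (1 / (u + hi)) * (\<integral>\<^sup>+w. ?F z w \<partial>lborel) \<partial>lborel)"
    by (intro nn_integral_cmult[symmetric]) measurable
  also have "\<dots> \<le> ?L"
  proof (rule nn_integral_mono)
    fix z :: real
    show "ennreal (1 / (u + hi)) * (\<integral>\<^sup>+w. ?F z w \<partial>lborel)
      \<le> (\<integral>\<^sup>+p. g (p * (z + b)) ((1 - p) * (z + b)) * indicator {0<..<1} p \<partial>lborel)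
            * indicator {l<..<u} z"
    proof (cases "l < z \<and> z < u")
      case True
      then have z: "0 < z + b" "z + b \<le> u + hi" using lo b l by auto
      have "(\<integral>\<^sup>+p. g (p * (z + b)) ((1 - p) * (z + b)) * indicator {0<..<1} p \<partial>lborel)
          = (\<integral>\<^sup>+p. g (p * (z + b)) (z + b - p * (z + b)) * indicator {0<..<1} p \<partial>lborel)"
        by (simp add: algebra_simps)
      also have "\<dots> = ennreal (1 / (z + b)) *
          (\<integral>\<^sup>+w. g w (z + b - w) * indicator {0<..<z + b} w \<partial>lborel)"
        using z by (subst nn_integral_unit_interval_scale[symmetric]) auto
      also have "(\<integral>\<^sup>+w. g w (z + b - w) * indicator {0<..<z + b} w \<partial>lborel)
          = (\<integral>\<^sup>+w. ?F z w \<partial>lborel)"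
        using True by (intro nn_integral_cong) (auto simp: indicator_def)
      finally show ?thesis
        using True z by (auto intro!: mult_right_mono ennreal_leI divide_left_mono)
    qed auto
  qed
  finally show ?thesis .
qed

text \<open>Only bath energies \<open>x\<close> in \<open>(u, u + 1)\<close> are kept. There the
  exponential density is at least \<open>exp (- (u + 1) / T) / T\<close>, and
  \<open>p * (a + x)\<close> is uniform on an interval that contains \<open>(l, u)\<close> and has
  length at most \<open>h + u + 1\<close>.\<close>

lemma nn_integral_bath_ge:
  fixes g :: "real \<Rightarrow> ennreal"
  assumes [measurable]: "g \<in> borel_measurable borel"
    and T: "0 < T" and a: "0 < a" "a \<le> h" and l: "0 \<le> l" "l \<le> u"
  shows "(\<integral>\<^sup>+x. (\<integral>\<^sup>+p. g (p * (a + x)) * indicator {0<..<1} p \<partial>lborel) \<partial>expo_mean T)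
    \<ge> ennreal (exp (- (u + 1) / T) / T / (h + u + 1)) *
       (\<integral>\<^sup>+w. g w * indicator {l<..<u} w \<partial>lborel)" (is "?L \<ge> ennreal ?c * ?R")
proof -
  let ?H = "\<lambda>x. \<integral>\<^sup>+p. g (p * (a + x)) * indicator {0<..<1} p \<partial>lborel"
  \<comment> \<open>The interval \<open>(u, u + 1)\<close> has length 1, so a constant equals its
    integral over it.\<close>
  have "ennreal ?c * ?R = (\<integral>\<^sup>+x. ennreal ?c * ?R * indicator {u<..<u+1} x \<partial>lborel)"
    by (subst nn_integral_cmult) auto
  also have "\<dots> \<le> (\<integral>\<^sup>+x. ennreal (exponential_density (1 / T) x) * ?H x \<partial>lborel)"
  proof (rule nn_integral_mono)
    fix x :: real
    show "ennreal ?c * ?R * indicator {u<..<u+1} x \<le> ennreal (exponential_density (1 / T) x) * ?H x"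
    proof (cases "u < x \<and> x < u + 1")
      case True
      then have x: "0 < x" "0 < a + x" "a + x \<le> h + u + 1" "u < a + x"
        using a l by auto
      have "exp (- (u + 1) / T) / T \<le> exponential_density (1 / T) x"
        using True x T by (auto simp: exponential_density_def divide_simps)
      moreover have "ennreal (1 / (h + u + 1)) * ?R \<le> ?H x"
      proof -
        have "?R \<le> (\<integral>\<^sup>+w. g w * indicator {0<..<a + x} w \<partial>lborel)"
          using x l by (intro nn_integral_mono) (auto simp: indicator_def)
        then show ?thesis
          using x by (subst nn_integral_unit_interval_scale)
            (auto intro!: mult_mono ennreal_leI divide_left_mono)
      qed
      ultimately have "ennreal (exp (- (u + 1) / T) / T) * (ennreal (1 / (h + u + 1)) * ?R)
          \<le> ennreal (exponential_density (1 / T) x) * ?H x"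
        by (intro mult_mono ennreal_leI) auto
      also have "ennreal (exp (- (u + 1) / T) / T) * (ennreal (1 / (h + u + 1)) * ?R) = ennreal ?c * ?R"
        using x T by (simp add: mult.assoc[symmetric] ennreal_mult''[symmetric])
      finally show ?thesis using True by simp
    qed auto
  qed
  also have "\<dots> = ?L"
    unfolding expo_mean_def by (subst nn_integral_density) auto
  finally show ?thesis .
qed

section \<open>The random inputs of a jump and the updates of a state\<close>

lemma sets_unif01 [simp, measurable_cong]: "sets unif01 = sets borel"
  by (simp add: unif01_def)

lemma space_unif01 [simp]: "space unif01 = UNIV"
  by (simp add: unif01_def)

lemma prob_space_unif01: "prob_space unif01"
  unfolding unif01_def by (rule prob_space_uniform_measure) auto

lemma sets_expo_mean [simp, measurable_cong]: "sets (expo_mean T) = sets borel"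
  by (simp add: expo_mean_def)

lemma space_expo_mean [simp]: "space (expo_mean T) = UNIV"
  by (simp add: expo_mean_def)

lemma prob_space_expo_mean: "0 < T \<Longrightarrow> prob_space (expo_mean T)"
  unfolding expo_mean_def by (rule prob_space_exponential_density) auto

lemma measurable_state_component:
  assumes "i \<in> {1..N}" "f \<in> measurable M (state_space N)"
  shows "(\<lambda>x. f x i) \<in> borel_measurable M"
  using measurable_compose[OF assms(2)[unfolded state_space_def] measurable_component_singleton[OF assms(1)]]
  by simp

lemma measurable_state_upd [measurable (raw)]:
  assumes "i \<in> {1..N}" "f \<in> measurable M (state_space N)" "h \<in> borel_measurable M"
  shows "(\<lambda>x. (f x)(i := h x)) \<in> measurable M (state_space N)"
  using assms unfolding state_space_def
  by (intro measurable_fun_upd[where J = "{1..N}"]) auto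

lemma state_upd_in_space:
  "E \<in> space (state_space N) \<Longrightarrow> i \<in> {1..N} \<Longrightarrow> E(i := a) \<in> space (state_space N)"
  by (auto simp: state_space_def space_PiM PiE_def extensional_def)

section \<open>The uniformized step as a measurable mixture of jump kernels\<close>

locale energy_exchange =
  fixes N :: nat and K TL TR :: real
  assumes N: "1 \<le> N" and K: "0 < K" and TL: "0 < TL" and TR: "0 < TR"
begin

abbreviation "S \<equiv> state_space N"
abbreviation "weight \<equiv> step_weight N K TL TR"
abbreviation "jump \<equiv> jump_kernel N TL TR"
abbreviation "step \<equiv> step_kernel N K TL TR"
abbreviation "iter \<equiv> step_iter N K TL TR"

lemma measurable_clock_rate [measurable]:
  assumes "j \<le> N"
  shows "(\<lambda>E. clock_rate N K TL TR E j) \<in> borel_measurable S"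
proof -
  have comp: "(\<lambda>E. E i) \<in> borel_measurable S" if "1 \<le> i" "i \<le> N" for i
    using that by (intro measurable_state_component measurable_ident_sets) auto
  consider "j = 0" | "j = N" "j \<noteq> 0" | "1 \<le> j" "Suc j \<le> N" "j \<noteq> 0" "j \<noteq> N"
    using assms by force
  then show ?thesis
    unfolding clock_rate_def rateR_def using N comp[of 1] comp[of N] comp[of j] comp[of "Suc j"]
    by cases (simp_all add: borel_measurable_min)
qed

lemma measurable_weight [measurable]: "(\<lambda>E. weight E j) \<in> borel_measurable S"
proof -
  have "(\<lambda>E. \<Sum>i\<le>N. clock_rate N K TL TR E i) \<in> borel_measurable S"
    by (intro borel_measurable_sum) auto
  then show ?thesis
    unfolding step_weight_def by (cases "j \<le> N") auto
qed

lemma prob_space_bath: "0 < T \<Longrightarrow> prob_space (unif01 \<Otimes>\<^sub>M expo_mean T)"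
  by (intro prob_space_pair prob_space_unif01 prob_space_expo_mean)

lemma measurable_jump: "j \<le> N \<Longrightarrow> (\<lambda>E. jump E j) \<in> measurable S (subprob_algebra S)"
proof -
  assume j: "j \<le> N"
  have const: "(\<lambda>_. M) \<in> measurable S (subprob_algebra M)" if "prob_space M" for M :: "'z measure"
    using that by (intro measurable_const) (auto simp: space_subprob_algebra intro: prob_space_imp_subprob_space)
  have comp [measurable]: "(\<lambda>x. fst x i) \<in> borel_measurable (S \<Otimes>\<^sub>M M)"
    if "i \<in> {1..N}" for i and M :: "'z measure"
    using that by (intro measurable_state_component) auto
  have bath: "(\<lambda>E. distr (unif01 \<Otimes>\<^sub>M expo_mean T) S (\<lambda>(p, x). E(i := p * (E i + x))))
      \<in> measurable S (subprob_algebra S)" if [measurable]: "i \<in> {1..N}" and "0 < T" for i T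
    by (rule measurable_distr2[where M = "unif01 \<Otimes>\<^sub>M expo_mean T"])
       (use const[OF prob_space_bath] that in \<open>auto simp: split_beta'\<close>)
  have exch: "(\<lambda>E. distr unif01 S
      (\<lambda>p. E(i := p * (E i + E (Suc i)), Suc i := (1 - p) * (E i + E (Suc i)))))
      \<in> measurable S (subprob_algebra S)" if [measurable]: "i \<in> {1..N}" "Suc i \<in> {1..N}" for i
    by (rule measurable_distr2[where M = unif01])
       (use const[OF prob_space_unif01] that in \<open>auto simp: split_beta'\<close>)
  consider "j = 0" | "j = N" "j \<noteq> 0" | "j \<in> {1..N}" "Suc j \<in> {1..N}" "j \<noteq> 0" "j \<noteq> N"
    using j by force
  then show ?thesis
    unfolding jump_kernel_def using bath[of 1 TL] bath[of N TR] exch[of j] N TL TR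
    by cases simp_all
qed

lemma prob_space_jump:
  assumes "E \<in> space S" "j \<le> N"
  shows "prob_space (jump E j)"
proof -
  have bath: "prob_space (distr (unif01 \<Otimes>\<^sub>M expo_mean T) S (\<lambda>(p, x). E(i := p * (E i + x))))"
    if "i \<in> {1..N}" and "0 < T" for i T
    unfolding split_beta'
    by (intro prob_space.prob_space_distr[OF prob_space_bath[OF that(2)]]
        measurable_state_upd measurable_const assms(1) that(1)) measurable
  have exch: "prob_space (distr unif01 S
      (\<lambda>p. E(i := p * (E i + E (Suc i)), Suc i := (1 - p) * (E i + E (Suc i)))))"
    if "i \<in> {1..N}" "Suc i \<in> {1..N}" for i
    by (intro prob_space.prob_space_distr[OF prob_space_unif01]
        measurable_state_upd measurable_const assms(1) that) measurable
  consider "j = 0" | "j = N" "j \<noteq> 0" | "j \<in> {1..N}" "Suc j \<in> {1..N}" "j \<noteq> 0" "j \<noteq> N"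
    using assms(2) by force
  then show ?thesis
    unfolding jump_kernel_def using bath[of 1 TL] bath[of N TR] exch[of j] N TL TR
    by cases simp_all
qed

definition branch :: "state \<Rightarrow> nat \<Rightarrow> state measure" where
  "branch E j = (if j \<le> N then jump E j else return S E)"

lemma measurable_branch: "(\<lambda>E. branch E j) \<in> measurable S (subprob_algebra S)"
  unfolding branch_def using measurable_jump return_measurable by (cases "j \<le> N") auto

lemma prob_space_branch: "E \<in> space S \<Longrightarrow> prob_space (branch E j)"
  unfolding branch_def using prob_space_jump by (auto intro: prob_space_return)

lemma sets_branch: "E \<in> space S \<Longrightarrow> sets (branch E j) = sets S"
  using measurable_space[OF measurable_branch] by (auto simp: space_subprob_algebra)

lemma step_eq: "step E = bind (point_measure {0..N+1} (\<lambda>j. ennreal (weight E j))) (branch E)"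
  unfolding step_kernel_def branch_def ..

lemma measurable_branch_index:
  "E \<in> space S \<Longrightarrow> branch E \<in> measurable (point_measure {0..N+1} w) (subprob_algebra S)"
  using measurable_space[OF measurable_branch, of E] by (auto simp: point_measure_def)

lemma sets_step: "E \<in> space S \<Longrightarrow> sets (step E) = sets S"
  unfolding step_eq by (subst sets_bind) (auto simp: sets_branch space_point_measure)

lemma nn_integral_step:
  assumes "E \<in> space S" "f \<in> borel_measurable S"
  shows "(\<integral>\<^sup>+x. f x \<partial>step E) = (\<Sum>j\<le>N+1. ennreal (weight E j) * (\<integral>\<^sup>+x. f x \<partial>branch E j))"
  unfolding step_eq
  by (subst nn_integral_bind[OF assms(2) measurable_branch_index[OF assms(1)]],
      subst nn_integral_point_measure_finite) (auto simp: atLeast0AtMost)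

lemma emeasure_step:
  assumes "E \<in> space S" "A \<in> sets S"
  shows "emeasure (step E) A = (\<Sum>j\<le>N+1. ennreal (weight E j) * emeasure (branch E j) A)"
  using nn_integral_step[OF assms(1), of "indicator A"] assms sets_step sets_branch by simp

text \<open>With a negative energy some rates are negative, the weights then sum to more than 1 and the
  step kernel is not a sub-probability; the iteration only sees the following set of states.\<close>

definition good :: "state set" where
  "good = {E \<in> space S. (\<Sum>j\<le>N+1. ennreal (weight E j)) \<le> 1}"

lemma good_sets [measurable]: "good \<in> sets S"
  unfolding good_def by measurable

lemma goodD: "E \<in> good \<Longrightarrow> E \<in> space S"
  by (simp add: good_def)

text \<open>Each branch has mass 1, so the mass of the step is the sum of the weights, with negative
  ones cut to 0 by \<open>ennreal\<close>. That cut is what lets the sum exceed 1.\<close>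

lemma subprob_step_iff:
  assumes "E \<in> space S"
  shows "subprob_space (step E) \<longleftrightarrow> E \<in> good"
proof -
  have sp: "space (step E) = space S"
    using sets_eq_imp_space_eq[OF sets_step[OF assms]] .
  have "emeasure (branch E j) (space S) = 1" for j
    using prob_space.emeasure_space_1[OF prob_space_branch[OF assms]]
      sets_eq_imp_space_eq[OF sets_branch[OF assms]] by metis
  then have e: "emeasure (step E) (space (step E)) = (\<Sum>j\<le>N+1. ennreal (weight E j))"
    unfolding sp using assms by (subst emeasure_step) auto
  have "space (step E) \<noteq> {}"
    using assms sp by auto
  then show ?thesis
    using e assms by (auto simp: good_def intro!: subprob_spaceI dest: subprob_space.emeasure_space_le_1)
qed

lemma measurable_step: "step \<in> measurable (restrict_space S good) (subprob_algebra S)"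
proof (rule measurable_subprob_algebra)
  fix A assume [measurable]: "A \<in> sets S"
  have [measurable]: "(\<lambda>E. emeasure (branch E j) A) \<in> borel_measurable S" for j
    by (rule measurable_compose[OF measurable_branch measurable_emeasure_subprob_algebra]) simp
  have "(\<lambda>E. \<Sum>j\<le>N+1. ennreal (weight E j) * emeasure (branch E j) A)
      \<in> borel_measurable (restrict_space S good)"
    by (intro measurable_restrict_space1) measurable
  then show "(\<lambda>E. emeasure (step E) A) \<in> borel_measurable (restrict_space S good)"
    by (subst measurable_cong[where g = "\<lambda>E. \<Sum>j\<le>N+1. ennreal (weight E j) * emeasure (branch E j) A"])
       (simp_all add: space_restrict_space emeasure_step goodD del: sum.atMost_Suc)
qed (simp_all add: space_restrict_space subprob_step_iff sets_step goodD)

lemma measurable_nn_integral_step: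
  assumes "f \<in> borel_measurable S"
  shows "(\<lambda>E. (\<integral>\<^sup>+x. f x \<partial>step E) * indicator good E) \<in> borel_measurable S"
  using measurable_compose[OF measurable_step nn_integral_measurable_subprob_algebra[OF assms]]
  by (subst (asm) borel_measurable_restrict_space_iff_ennreal) auto

text \<open>The recursion of \<open>step_iter\<close> binds over the whole state space, while
  \<open>step\<close> is a measurable sub-probability kernel on \<open>good\<close> only; this
  passes to the restriction, where the usual rules for \<open>bind\<close> apply.\<close>

lemma bind_step_eq:
  assumes "sets M = sets S" "good \<noteq> {}"
  shows "bind M step = bind (restrict_space M good) step"
proof (rule bind_restrict_space[where S = S])
  have "space M = space S" using assms(1) by (rule sets_eq_imp_space_eq)
  then show "\<And>x. x \<in> space M \<Longrightarrow> x \<notin> good \<Longrightarrow> \<not> subprob_space (step x)"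
    "\<And>x. x \<in> space M \<Longrightarrow> sets (step x) = sets S"
    by (auto simp: subprob_step_iff sets_step)
qed (use assms in auto)

lemma measurable_step_cong:
  "sets M = sets S \<Longrightarrow> step \<in> measurable (restrict_space M good) (subprob_algebra S)"
  using measurable_step measurable_cong_sets[OF sets_restrict_space_cong refl] by blast

section \<open>Iterates of the step and the Poisson mixture\<close>

lemma subprob_iter:
  assumes "E \<in> good"
  shows "subprob_space (iter n E) \<and> sets (iter n E) = sets S"
proof (induction n)
  case 0
  then show ?case
    using assms by (auto simp: good_def intro!: prob_space_imp_subprob_space prob_space_return)
next
  case (Suc n)
  then have sub: "subprob_space (iter n E)" and sets: "sets (iter n E) = sets S"
    by auto
  \<comment> \<open>A sub-probability space must be nonempty; the starting state itself witnesses
    this for the restriction to \<open>good\<close>.\<close>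
  have "E \<in> space (iter n E)"
    unfolding sets_eq_imp_space_eq[OF sets] using assms by (rule goodD)
  with assms have ne: "good \<inter> space (iter n E) \<noteq> {}"
    by blast
  from assms have "good \<noteq> {}"
    by blast
  then have eq: "iter (Suc n) E = bind (restrict_space (iter n E) good) step"
    unfolding step_iter.simps by (rule bind_step_eq[OF sets])
  have st: "step \<in> measurable (restrict_space (iter n E) good) (subprob_algebra S)"
    using sets by (rule measurable_step_cong)
  have "good \<inter> space (iter n E) \<in> sets (iter n E)"
    unfolding sets sets_eq_imp_space_eq[OF sets] by auto
  then have "subprob_space (restrict_space (iter n E) good)"
    using sub ne by (intro subprob_space_restrict_space)
  then show ?case
    unfolding eq using ne st
    by (metis subprob_space_bind sets_bind_measurable space_restrict_space)
qed

text \<open>Chapman-Kolmogorov with the last step split off. The inner integral, cut off by the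
  indicator of \<open>good\<close>, is a measurable function again, so a bound for \<open>n\<close>
  steps and all measurable functions applies to it.\<close>

lemma nn_integral_iter_Suc:
  assumes "E \<in> good" "f \<in> borel_measurable S"
  shows "(\<integral>\<^sup>+x. f x \<partial>iter (Suc n) E)
    = (\<integral>\<^sup>+x. (\<integral>\<^sup>+y. f y \<partial>step x) * indicator good x \<partial>iter n E)"
proof -
  have s: "sets (iter n E) = sets S" using subprob_iter[OF assms(1)] by blast
  then have "(\<integral>\<^sup>+x. f x \<partial>iter (Suc n) E)
    = (\<integral>\<^sup>+x. (\<integral>\<^sup>+y. f y \<partial>step x) \<partial>restrict_space (iter n E) good)"
    using bind_step_eq[OF s] assms(1) nn_integral_bind[OF assms(2) measurable_step_cong[OF s]]
    by (metis empty_iff step_iter.simps(2))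
  also have "\<dots> = (\<integral>\<^sup>+x. (\<integral>\<^sup>+y. f y \<partial>step x) * indicator good x \<partial>iter n E)"
    by (intro nn_integral_restrict_space) (use s sets_eq_imp_space_eq[OF s] in simp)
  finally show ?thesis .
qed

text \<open>Of the Poisson mixture over the number of steps only the term \<open>n\<close> is
  kept.\<close>

lemma transition_ge:
  assumes "E \<in> good" "A \<in> sets S" "0 < t"
  shows "ennreal (pmf (poisson_pmf (unif_rate N K * t)) n) * emeasure (iter n E) A
    \<le> emeasure (transition N K TL TR t E) A"
proof -
  let ?p = "poisson_pmf (unif_rate N K * t)"
  have "(\<lambda>n. iter n E) \<in> measurable (measure_pmf ?p) (subprob_algebra S)"
    unfolding measurable_pmf_measure1 space_subprob_algebra
    using subprob_iter[OF assms(1)] by blast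
  then have "emeasure (transition N K TL TR t E) A = (\<integral>\<^sup>+n. emeasure (iter n E) A \<partial>?p)"
    unfolding transition_def using assms(2) by (intro emeasure_bind) simp_all
  also have "\<dots> = (\<integral>\<^sup>+n. ennreal (pmf ?p n) * emeasure (iter n E) A \<partial>count_space UNIV)"
    by (rule nn_integral_measure_pmf)
  also have "\<dots> \<ge> ennreal (pmf ?p n) * emeasure (iter n E) A"
    by (rule nn_integral_ge_point) simp
  finally show ?thesis .
qed

text \<open>For nonnegative energies all \<open>N + 1\<close> rates lie between 0 and
  \<open>K\<close>, so their sum is at most the uniformization rate. The idle index
  \<open>N + 1\<close> takes the remaining mass, and the weights form a probability vector.\<close>

lemma good_nonneg:
  assumes "E \<in> space S" "\<And>i. i \<in> {1..N} \<Longrightarrow> 0 \<le> E i"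
  shows "E \<in> good"
proof -
  have rate: "0 \<le> clock_rate N K TL TR E j \<and> clock_rate N K TL TR E j \<le> K" if "j \<le> N" for j
    using that assms(2)[of 1] assms(2)[of N] assms(2)[of j] assms(2)[of "Suc j"] N K TL TR
    by (auto simp: clock_rate_def rateR_def)
  have L: "0 < unif_rate N K"
    using K by (simp add: unif_rate_def)
  have "(\<Sum>j\<le>N. clock_rate N K TL TR E j) \<le> (\<Sum>j\<le>N. K)"
    using rate by (intro sum_mono) auto
  then have le: "(\<Sum>j\<le>N. clock_rate N K TL TR E j) \<le> unif_rate N K"
    by (simp add: unif_rate_def)
  have "0 \<le> weight E j" for j
    using rate L le by (auto simp: step_weight_def)
  then have "(\<Sum>j\<le>N+1. ennreal (weight E j)) = ennreal (\<Sum>j\<le>N+1. weight E j)"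
    by (intro sum_ennreal) auto
  also have "(\<Sum>j\<le>N+1. weight E j) = 1"
    by (simp add: step_weight_def sum_divide_distrib)
  finally show ?thesis
    using assms(1) by (simp add: good_def)
qed

section \<open>Lower bounds for one step from states with energies bounded below\<close>

text \<open>The rate function is monotone, and each of its arguments is a bath temperature or an
  energy. If all energies are at least \<open>lo\<close>, this number therefore bounds the firing
  probability of every clock from below.\<close>

definition weight_bound :: "real \<Rightarrow> real" where
  "weight_bound lo = rateR K (min TL TR) lo / unif_rate N K"

lemma weight_bound_pos: "0 < lo \<Longrightarrow> 0 < weight_bound lo"
  using K TL TR by (auto simp: weight_bound_def rateR_def unif_rate_def)

text \<open>Only the branch of clock \<open>j\<close> is kept. The indicator of \<open>good\<close>
  equals 1 at \<open>x\<close>; it is written out so that the bound fits the integrand of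
  \<open>nn_integral_iter_Suc\<close>.\<close>

lemma nn_integral_step_ge:
  assumes x: "x \<in> space S" "\<And>i. i \<in> {1..N} \<Longrightarrow> lo \<le> x i" and lo: "0 < lo"
    and f: "f \<in> borel_measurable S" and j: "j \<le> N"
  shows "ennreal (weight_bound lo) * (\<integral>\<^sup>+y. f y \<partial>jump x j)
    \<le> (\<integral>\<^sup>+y. f y \<partial>step x) * indicator good x"
proof -
  have x0: "0 \<le> x i" if "i \<in> {1..N}" for i
    using x(2)[OF that] lo by simp
  have good: "x \<in> good"
    using x(1) x0 by (rule good_nonneg)
  have rate: "rateR K (min TL TR) lo \<le> rateR K a b" if "min TL TR \<le> a \<or> lo \<le> a" "min TL TR \<le> b \<or> lo \<le> b" for a b
  proof -
    have "min (min TL TR) lo \<le> min a b"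
      using that by auto
    then show ?thesis
      unfolding rateR_def by (intro min.mono[OF order_refl real_sqrt_le_mono])
  qed
  have "rateR K (min TL TR) lo \<le> clock_rate N K TL TR x j"
    using j x(2)[of 1] x(2)[of N] x(2)[of j] x(2)[of "Suc j"] N
    unfolding clock_rate_def by (auto intro!: rate)
  then have "weight_bound lo \<le> weight x j"
    using j K by (auto simp: weight_bound_def step_weight_def unif_rate_def intro!: divide_right_mono)
  then have "ennreal (weight_bound lo) * (\<integral>\<^sup>+y. f y \<partial>jump x j)
      \<le> ennreal (weight x j) * (\<integral>\<^sup>+y. f y \<partial>branch x j)"
    using j by (auto simp: branch_def intro!: mult_right_mono ennreal_leI)
  also have "\<dots> \<le> (\<Sum>j\<le>N+1. ennreal (weight x j) * (\<integral>\<^sup>+y. f y \<partial>branch x j))"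
    using j by (intro member_le_sum) auto
  finally show ?thesis
    using good nn_integral_step[OF x(1) f] by simp
qed

lemma measurable_upd:
  assumes "f \<in> borel_measurable S" "x \<in> space S" "i \<in> {1..N}"
  shows "(\<lambda>w. f (x(i := w))) \<in> borel_measurable borel"
  using assms by (intro measurable_compose[OF _ assms(1)] measurable_state_upd measurable_const) auto

lemma nn_integral_bath:
  assumes f: "f \<in> borel_measurable S" and x: "x \<in> space S" and i: "i \<in> {1..N}" and T: "0 < T"
  shows "(\<integral>\<^sup>+y. f y \<partial>distr (unif01 \<Otimes>\<^sub>M expo_mean T) S (\<lambda>(p, X). x(i := p * (x i + X))))
    = (\<integral>\<^sup>+X. (\<integral>\<^sup>+p. f (x(i := p * (x i + X))) * indicator {0<..<1} p \<partial>lborel) \<partial>expo_mean T)"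
proof -
  interpret U: prob_space unif01 by (rule prob_space_unif01)
  interpret X: prob_space "expo_mean T" using T by (rule prob_space_expo_mean)
  interpret P: pair_prob_space unif01 "expo_mean T" ..
  have [measurable]: "(\<lambda>w. f (x(i := w))) \<in> borel_measurable borel"
    using f x i by (rule measurable_upd)
  have upd: "(\<lambda>(p, X). x(i := p * (x i + X))) \<in> measurable (unif01 \<Otimes>\<^sub>M expo_mean T) S"
    unfolding split_beta' using x i by (intro measurable_state_upd measurable_const) measurable
  have "(\<integral>\<^sup>+y. f y \<partial>distr (unif01 \<Otimes>\<^sub>M expo_mean T) S (\<lambda>(p, X). x(i := p * (x i + X))))
    = (\<integral>\<^sup>+X. (\<integral>\<^sup>+p. f (x(i := p * (x i + X))) \<partial>unif01) \<partial>expo_mean T)"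
  proof -
    have m: "(\<lambda>(p, X). f (x(i := p * (x i + X)))) \<in> borel_measurable (unif01 \<Otimes>\<^sub>M expo_mean T)"
      by measurable
    show ?thesis
      using P.nn_integral_snd[OF m] f by (simp add: nn_integral_distr[OF upd[unfolded split_beta']] split_beta')
  qed
  also have "\<dots> = (\<integral>\<^sup>+X. (\<integral>\<^sup>+p. f (x(i := p * (x i + X))) * indicator {0<..<1} p \<partial>lborel) \<partial>expo_mean T)"
    by (intro nn_integral_cong nn_integral_unif01) measurable
  finally show ?thesis .
qed

lemma nn_integral_jump_exchange:
  assumes f: "f \<in> borel_measurable S" and x: "x \<in> space S" and j: "1 \<le> j" "j < N"
  shows "(\<integral>\<^sup>+y. f y \<partial>jump x j)
    = (\<integral>\<^sup>+p. f (x(j := p * (x j + x (Suc j)), Suc j := (1 - p) * (x j + x (Suc j))))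
        * indicator {0<..<1} p \<partial>lborel)"
proof -
  let ?u = "\<lambda>p. x(j := p * (x j + x (Suc j)), Suc j := (1 - p) * (x j + x (Suc j)))"
  have u: "?u \<in> measurable borel S"
    using x j by (intro measurable_state_upd measurable_const) auto
  then have u': "?u \<in> measurable unif01 S"
    by (simp cong: measurable_cong_sets)
  have "(\<integral>\<^sup>+y. f y \<partial>jump x j) = (\<integral>\<^sup>+p. f (?u p) \<partial>unif01)"
    using j f by (simp add: jump_kernel_def nn_integral_distr[OF u'])
  also have "\<dots> = (\<integral>\<^sup>+p. f (?u p) * indicator {0<..<1} p \<partial>lborel)"
    by (rule nn_integral_unif01) (rule measurable_compose[OF u f])
  finally show ?thesis .
qed

section \<open>Integration over the sites already brought back to the box\<close>

definition splice :: "nat \<Rightarrow> state \<Rightarrow> state \<Rightarrow> state" where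
  "splice k E y = (\<lambda>i\<in>{1..N}. if i \<le> k then y i else E i)"

text \<open>The first \<open>k\<close> sites are integrated over the box against Lebesgue measure
  and the others are frozen at \<open>E\<close>. This is the part of the lower bound that describes
  the sites already passed by the sweep of clocks.\<close>

definition fill :: "real \<Rightarrow> real \<Rightarrow> nat \<Rightarrow> (state \<Rightarrow> ennreal) \<Rightarrow> state \<Rightarrow> ennreal" where
  "fill lo hi k g E = (\<integral>\<^sup>+y. g (splice k E y) * indicator ({1..k} \<rightarrow>\<^sub>E {lo<..<hi}) y \<partial>state_space k)"

lemma measurable_splice: "k \<le> N \<Longrightarrow> splice k E \<in> measurable (state_space k) S"
  unfolding splice_def state_space_def
proof (intro measurable_restrict)
  fix i assume "i \<in> {1..N}"
  then show "(\<lambda>y. if i \<le> k then y i else E i) \<in> measurable (PiM {1..k} (\<lambda>_. lborel)) lborel"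
    by (cases "i \<le> k") auto
qed

lemma splice_space: "splice k E y \<in> space S"
  by (auto simp: splice_def state_space_def space_PiM)

lemma box_sets [measurable]: "({1..k} \<rightarrow>\<^sub>E {lo<..<hi}) \<in> sets (state_space k)"
  unfolding state_space_def by (intro sets_PiM_I_finite) auto

lemma fill_0:
  assumes "E \<in> space S"
  shows "fill lo hi 0 g E = g E"
proof -
  interpret product_sigma_finite "\<lambda>_::nat. lborel :: real measure"
    by standard
  have "splice 0 E y = E" for y
    using assms by (auto simp: splice_def state_space_def space_PiM PiE_def extensional_def fun_eq_iff)
  then show ?thesis
    by (simp add: fill_def state_space_def nn_integral_empty)
qed

text \<open>For \<open>k = N\<close> nothing of \<open>E\<close> remains, and the integral of an
  indicator becomes a volume inside the box.\<close>

lemma fill_N: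
  assumes "A \<in> sets S"
  shows "fill lo hi N (indicator A) E = emeasure S (A \<inter> ({1..N} \<rightarrow>\<^sub>E {lo<..<hi}))"
proof -
  have "splice N E y = y" if "y \<in> space S" for y
    using that by (auto simp: splice_def state_space_def space_PiM PiE_def extensional_def fun_eq_iff)
  then have "fill lo hi N (indicator A) E
      = (\<integral>\<^sup>+y. indicator (A \<inter> ({1..N} \<rightarrow>\<^sub>E {lo<..<hi})) y \<partial>S)"
    unfolding fill_def by (intro nn_integral_cong) (auto simp: indicator_inter_arith)
  also have "\<dots> = emeasure S (A \<inter> ({1..N} \<rightarrow>\<^sub>E {lo<..<hi}))"
    using assms box_sets by (intro nn_integral_indicator) (rule sets.Int)
  finally show ?thesis .
qed

text \<open>Tonelli for the coordinate \<open>Suc k\<close>: its integral is moved into the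
  integrand, where an estimate for the next clock can act on it.\<close>

lemma fill_Suc:
  assumes k: "k < N" and g: "g \<in> borel_measurable S"
  shows "fill lo hi (Suc k) g E
    = fill lo hi k (\<lambda>x. \<integral>\<^sup>+w. g (x(Suc k := w)) * indicator {lo<..<hi} w \<partial>lborel) E"
proof -
  interpret product_sigma_finite "\<lambda>_::nat. lborel :: real measure"
    by standard
  have ins: "{1..Suc k} = insert (Suc k) {1..k}"
    by auto
  have m: "(\<lambda>y. g (splice (Suc k) E y) * indicator ({1..Suc k} \<rightarrow>\<^sub>E {lo<..<hi}) y)
      \<in> borel_measurable (PiM (insert (Suc k) {1..k}) (\<lambda>_. lborel))"
    using measurable_compose[OF measurable_splice g, of "Suc k" E] k box_sets[of "Suc k" lo hi]
    unfolding state_space_def ins by (intro borel_measurable_times_ennreal borel_measurable_indicator) auto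
  have "fill lo hi (Suc k) g E = (\<integral>\<^sup>+y. (\<integral>\<^sup>+w. g (splice (Suc k) E (y(Suc k := w)))
      * indicator ({1..Suc k} \<rightarrow>\<^sub>E {lo<..<hi}) (y(Suc k := w)) \<partial>lborel) \<partial>state_space k)"
    unfolding fill_def state_space_def ins
    by (rule product_nn_integral_insert) (use m ins in auto)
  also have "\<dots> = (\<integral>\<^sup>+y. (\<integral>\<^sup>+w. g ((splice k E y)(Suc k := w)) * indicator {lo<..<hi} w \<partial>lborel)
      * indicator ({1..k} \<rightarrow>\<^sub>E {lo<..<hi}) y \<partial>state_space k)"
  proof (rule nn_integral_cong)
    fix y assume y: "y \<in> space (state_space k)"
    have [measurable]: "(\<lambda>w. g ((splice k E y)(Suc k := w))) \<in> borel_measurable borel"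
      using k by (intro measurable_upd[OF g splice_space]) auto
    have "splice (Suc k) E (y(Suc k := w)) = (splice k E y)(Suc k := w)" for w
      using k by (auto simp: splice_def fun_eq_iff)
    moreover have "indicator ({1..Suc k} \<rightarrow>\<^sub>E {lo<..<hi}) (y(Suc k := w))
        = (indicator {lo<..<hi} w * indicator ({1..k} \<rightarrow>\<^sub>E {lo<..<hi}) y :: ennreal)" for w
      using y unfolding state_space_def space_PiM
      by (auto simp: indicator_def PiE_def extensional_def Pi_iff le_Suc_eq)
    ultimately show "(\<integral>\<^sup>+w. g (splice (Suc k) E (y(Suc k := w)))
        * indicator ({1..Suc k} \<rightarrow>\<^sub>E {lo<..<hi}) (y(Suc k := w)) \<partial>lborel)
      = (\<integral>\<^sup>+w. g ((splice k E y)(Suc k := w)) * indicator {lo<..<hi} w \<partial>lborel)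
        * indicator ({1..k} \<rightarrow>\<^sub>E {lo<..<hi}) y"
      by (subst nn_integral_multc[symmetric]) (auto simp: mult.assoc)
  qed
  also have "\<dots> = fill lo hi k (\<lambda>x. \<integral>\<^sup>+w. g (x(Suc k := w)) * indicator {lo<..<hi} w \<partial>lborel) E"
    by (simp add: fill_def)
  finally show ?thesis .
qed

text \<open>With \<open>E\<close> and the integration variable both in the box, every spliced state
  lies in the box, so a pointwise inequality is required only there.\<close>

lemma fill_mono:
  assumes k: "k \<le> N" and g: "g \<in> borel_measurable S"
    and E: "\<And>i. i \<in> {1..N} \<Longrightarrow> lo < E i \<and> E i < hi"
    and le: "\<And>x. x \<in> space S \<Longrightarrow> (\<And>i. i \<in> {1..N} \<Longrightarrow> lo < x i \<and> x i < hi) \<Longrightarrow> c * g x \<le> h x"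
  shows "c * fill lo hi k g E \<le> fill lo hi k h E"
proof -
  have [measurable]: "(\<lambda>y. g (splice k E y)) \<in> borel_measurable (state_space k)"
    using k by (rule measurable_compose[OF measurable_splice g])
  have "c * fill lo hi k g E
      = (\<integral>\<^sup>+y. c * (g (splice k E y) * indicator ({1..k} \<rightarrow>\<^sub>E {lo<..<hi}) y) \<partial>state_space k)"
    unfolding fill_def by (rule nn_integral_cmult[symmetric]) measurable
  also have "\<dots> \<le> fill lo hi k h E"
    unfolding fill_def
  proof (rule nn_integral_mono)
    fix y
    show "c * (g (splice k E y) * indicator ({1..k} \<rightarrow>\<^sub>E {lo<..<hi}) y)
      \<le> h (splice k E y) * indicator ({1..k} \<rightarrow>\<^sub>E {lo<..<hi}) y"
    proof (cases "y \<in> {1..k} \<rightarrow>\<^sub>E {lo<..<hi}")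
      case True
      then have "lo < splice k E y i \<and> splice k E y i < hi" if "i \<in> {1..N}" for i
        using that E[OF that] PiE_mem[OF True, of i] by (auto simp: splice_def)
      then show ?thesis
        using le[OF splice_space] True by auto
    qed auto
  qed
  finally show ?thesis .
qed

lemma measurable_fill_inner:
  assumes f: "f \<in> borel_measurable S" and i: "i \<in> {1..N}"
  shows "(\<lambda>x. \<integral>\<^sup>+z. f (x(i := z)) * indicator {l<..<u} z \<partial>lborel) \<in> borel_measurable S"
proof -
  have [measurable]: "(\<lambda>p. f ((fst p)(i := snd p))) \<in> borel_measurable (S \<Otimes>\<^sub>M lborel)"
    using i by (intro measurable_compose[OF _ f] measurable_state_upd) auto
  show ?thesis
    by (intro lborel.borel_measurable_nn_integral) (auto simp: split_beta')
qed

lemma nn_integral_bath_jump_ge: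
  assumes f: "f \<in> borel_measurable S" and x: "x \<in> space S" and i: "i \<in> {1..N}" and T: "0 < T"
    and a: "0 < x i" "x i \<le> h" and l: "0 \<le> l" "l \<le> u"
  shows "ennreal (exp (- (u + 1) / T) / T / (h + u + 1)) *
      (\<integral>\<^sup>+w. f (x(i := w)) * indicator {l<..<u} w \<partial>lborel)
    \<le> (\<integral>\<^sup>+y. f y \<partial>distr (unif01 \<Otimes>\<^sub>M expo_mean T) S (\<lambda>(p, X). x(i := p * (x i + X))))"
  unfolding nn_integral_bath[OF f x i T]
  by (rule nn_integral_bath_ge[OF measurable_upd[OF f x i] T a l])

section \<open>The sweep of the clocks 0 to N\<close>

context
  fixes lo hi :: real
  assumes lo: "0 < lo" and lohi: "lo < hi"
begin

text \<open>The interval of large energies for site \<open>k\<close> just before clock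
  \<open>k\<close> fires. Each exchange costs \<open>hi\<close> at both ends, so starting from
  \<open>(hi, (3 * N - 1) * hi)\<close> at site 1 the window is still
  \<open>(N * hi, 2 * N * hi)\<close> at site \<open>N\<close>.\<close>

abbreviation "window k f x \<equiv>
  (\<integral>\<^sup>+z. f (x(k := z)) * indicator {real k * hi<..<real (3 * N - k) * hi} z \<partial>lborel)"

abbreviation "in_box x \<equiv> (\<forall>i\<in>{1..N}. lo < x i \<and> x i < hi)"

lemma hi: "0 < hi"
  using lo lohi by simp

lemma box_good:
  assumes "E \<in> space S" "in_box E"
  shows "E \<in> good"
proof (rule good_nonneg[OF assms(1)])
  fix i assume "i \<in> {1..N}"
  with assms(2) have "lo < E i" by blast
  with lo show "0 \<le> E i" by simp
qed

text \<open>One firing of clock \<open>k\<close> moves site \<open>k\<close> from its window into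
  the box and site \<open>k + 1\<close> from the box into its window. The constant is the firing
  probability bound divided by a bound for the Jacobian.\<close>

lemma window_exchange_ge:
  assumes f: "f \<in> borel_measurable S" and x: "x \<in> space S" "in_box x" and k: "1 \<le> k" "k < N"
  shows "ennreal (weight_bound lo / (real (3 * N) * hi)) *
      (\<integral>\<^sup>+w. window (Suc k) f (x(k := w)) * indicator {lo<..<hi} w \<partial>lborel)
    \<le> window k (\<lambda>y. (\<integral>\<^sup>+y'. f y' \<partial>step y) * indicator good y) x"
proof -
  let ?l = "real k * hi" and ?u = "real (3 * N - k) * hi" and ?b = "x (Suc k)"
  let ?g = "\<lambda>w v. f (x(k := w, Suc k := v))"
  let ?G = "\<lambda>z p. ?g (p * (z + ?b)) ((1 - p) * (z + ?b)) * indicator {0<..<1} p"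
  have upd: "(\<lambda>q. x(k := fst q, Suc k := snd q)) \<in> measurable (borel \<Otimes>\<^sub>M borel) S"
    using x k by (intro measurable_state_upd measurable_const) auto
  have g: "case_prod ?g \<in> borel_measurable (borel \<Otimes>\<^sub>M borel)"
    using measurable_compose[OF upd f] by (simp add: split_beta')
  have gm [measurable (raw)]: "(\<lambda>q. ?g (h q) (h' q)) \<in> borel_measurable M"
    if [measurable]: "h \<in> borel_measurable M" "h' \<in> borel_measurable M" for h h' and M :: "'z measure"
  proof -
    have "(\<lambda>q. case_prod ?g (h q, h' q)) \<in> borel_measurable M"
      by (rule measurable_compose[OF _ g]) measurable
    then show ?thesis by simp
  qed
  have b: "lo < ?b" "?b < hi"
    using x(2) k by auto
  \<comment> \<open>Consecutive windows differ by exactly the loss in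
    \<open>nn_integral_exchange_ge\<close>. The last inequality uses \<open>k\<close> \<ge> 1 and
    bounds the Jacobian uniformly in \<open>k\<close>.\<close>
  have lu: "real (Suc k) * hi = ?l + hi" "real (3 * N - Suc k) * hi = ?u - hi" "?u + hi \<le> real (3 * N) * hi"
    using k hi by (auto simp: algebra_simps of_nat_diff)
  have "ennreal (1 / (real (3 * N) * hi)) *
        (\<integral>\<^sup>+w. (\<integral>\<^sup>+v. ?g w v * indicator {?l + hi<..<?u - hi} v \<partial>lborel) * indicator {lo<..<hi} w \<partial>lborel)
      \<le> ennreal (1 / (?u + hi)) *
        (\<integral>\<^sup>+w. (\<integral>\<^sup>+v. ?g w v * indicator {?l + hi<..<?u - hi} v \<partial>lborel) * indicator {lo<..<hi} w \<partial>lborel)"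
    using lu(3) hi k by (intro mult_right_mono ennreal_leI divide_left_mono mult_pos_pos add_nonneg_pos) auto
  also have "\<dots> \<le> (\<integral>\<^sup>+z. (\<integral>\<^sup>+p. ?G z p \<partial>lborel) * indicator {?l<..<?u} z \<partial>lborel)"
    using hi by (intro nn_integral_exchange_ge[OF g lo b]) auto
  finally have 1: "ennreal (1 / (real (3 * N) * hi)) *
        (\<integral>\<^sup>+w. window (Suc k) f (x(k := w)) * indicator {lo<..<hi} w \<partial>lborel)
      \<le> (\<integral>\<^sup>+z. (\<integral>\<^sup>+p. ?G z p \<partial>lborel) * indicator {?l<..<?u} z \<partial>lborel)"
    unfolding lu .
  have "ennreal (weight_bound lo / (real (3 * N) * hi)) *
      (\<integral>\<^sup>+w. window (Suc k) f (x(k := w)) * indicator {lo<..<hi} w \<partial>lborel)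
    = ennreal (weight_bound lo) * (ennreal (1 / (real (3 * N) * hi)) *
        (\<integral>\<^sup>+w. window (Suc k) f (x(k := w)) * indicator {lo<..<hi} w \<partial>lborel))"
    using hi weight_bound_pos[OF lo] by (simp add: mult.assoc[symmetric] ennreal_mult'[symmetric])
  also have "\<dots> \<le> ennreal (weight_bound lo) *
      (\<integral>\<^sup>+z. (\<integral>\<^sup>+p. ?G z p \<partial>lborel) * indicator {?l<..<?u} z \<partial>lborel)"
    using 1 by (intro mult_left_mono) auto
  also have "\<dots> = (\<integral>\<^sup>+z. ennreal (weight_bound lo) *
      ((\<integral>\<^sup>+p. ?G z p \<partial>lborel) * indicator {?l<..<?u} z) \<partial>lborel)"
    by (rule nn_integral_cmult[symmetric]) measurable
  also have "\<dots> \<le> window k (\<lambda>y. (\<integral>\<^sup>+y'. f y' \<partial>step y) * indicator good y) x"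
  proof (rule nn_integral_mono)
    fix z
    let ?x = "x(k := z)"
    show "ennreal (weight_bound lo) * ((\<integral>\<^sup>+p. ?G z p \<partial>lborel) * indicator {?l<..<?u} z)
      \<le> (\<integral>\<^sup>+y'. f y' \<partial>step ?x) * indicator good ?x * indicator {?l<..<?u} z"
    proof (cases "?l < z \<and> z < ?u")
      case True
      \<comment> \<open>The state has left the box at site \<open>k\<close>, but only upwards, so
        the bound on the firing probability still applies.\<close>
      have "hi \<le> ?l" using k hi by simp
      then have z: "lo \<le> z" using True lohi by simp
      have sp: "?x \<in> space S"
        using x(1) k by (intro state_upd_in_space) auto
      have ge: "lo \<le> ?x i" if "i \<in> {1..N}" for i
        using x(2) that z by (auto intro: less_imp_le)
      have "ennreal (weight_bound lo) * (\<integral>\<^sup>+p. ?G z p \<partial>lborel)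
          = ennreal (weight_bound lo) * (\<integral>\<^sup>+y. f y \<partial>jump ?x k)"
        by (subst nn_integral_jump_exchange[OF f sp k]) simp
      also have "\<dots> \<le> (\<integral>\<^sup>+y'. f y' \<partial>step ?x) * indicator good ?x"
        using k by (intro nn_integral_step_ge[OF sp ge lo f]) auto
      finally show ?thesis using True by simp
    qed auto
  qed
  finally show ?thesis .
qed

text \<open>The bath returns site \<open>N\<close> to \<open>(lo, hi)\<close> with a density bound
  that holds for all old energies \<open>z\<close> up to \<open>3 * N * hi\<close>. Being
  independent of \<open>z\<close>, it only picks up the length \<open>N * hi\<close> of the
  window.\<close>

lemma window_bath_ge:
  assumes f: "f \<in> borel_measurable S" and x: "x \<in> space S" "in_box x"
  shows "ennreal (weight_bound lo * (exp (- (hi + 1) / TR) / TR / (real (3 * N) * hi + hi + 1)) * (real N * hi)) *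
      (\<integral>\<^sup>+w. f (x(N := w)) * indicator {lo<..<hi} w \<partial>lborel)
    \<le> window N (\<lambda>y. (\<integral>\<^sup>+y'. f y' \<partial>step y) * indicator good y) x" (is "ennreal (_ * ?c * _) * ?I \<le> _")
proof -
  have c: "0 < ?c" using TR hi by (simp add: add_nonneg_pos)
  let ?l = "real N * hi" and ?u = "real (3 * N - N) * hi"
  have len: "emeasure lborel {?l<..<?u} = ennreal (real N * hi)"
    using hi N by (simp add: of_nat_diff algebra_simps)
  have split: "ennreal (a * b * r) * I = (ennreal a * (ennreal b * I)) * ennreal r"
    if "0 \<le> a" "0 \<le> b" "0 \<le> r" for a b r I
    using that by (simp add: ennreal_mult' ac_simps)
  have "ennreal (weight_bound lo * ?c * (real N * hi)) * ?I
      = (\<integral>\<^sup>+z. (ennreal (weight_bound lo) * (ennreal ?c * ?I)) * indicator {?l<..<?u} z \<partial>lborel)"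
    using weight_bound_pos[OF lo] c hi
    by (subst nn_integral_cmult_indicator) (simp, unfold len, intro split, auto)
  also have "\<dots> \<le> window N (\<lambda>y. (\<integral>\<^sup>+y'. f y' \<partial>step y) * indicator good y) x"
  proof (rule nn_integral_mono)
    fix z
    let ?x = "x(N := z)"
    show "(ennreal (weight_bound lo) * (ennreal ?c * ?I)) * indicator {?l<..<?u} z
      \<le> (\<integral>\<^sup>+y'. f y' \<partial>step ?x) * indicator good ?x * indicator {?l<..<?u} z"
    proof (cases "?l < z \<and> z < ?u")
      case True
      have "hi \<le> ?l" using N hi by simp
      then have z: "lo \<le> z" using True lohi by simp
      have "?u \<le> real (3 * N) * hi" using hi by (intro mult_right_mono) auto
      then have z': "z \<le> real (3 * N) * hi" using True by simp
      have sp: "?x \<in> space S"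
        using x(1) N by (intro state_upd_in_space) auto
      have ge: "lo \<le> ?x i" if "i \<in> {1..N}" for i
        using x(2) that z by (auto intro: less_imp_le)
      have "ennreal ?c * ?I \<le> (\<integral>\<^sup>+y. f y \<partial>jump ?x N)"
        using nn_integral_bath_jump_ge[OF f sp _ TR, of N "real (3 * N) * hi" lo hi] z z' lo lohi N
        by (simp add: jump_kernel_def)
      then have "ennreal (weight_bound lo) * (ennreal ?c * ?I)
          \<le> ennreal (weight_bound lo) * (\<integral>\<^sup>+y. f y \<partial>jump ?x N)"
        by (intro mult_left_mono) auto
      also have "\<dots> \<le> (\<integral>\<^sup>+y'. f y' \<partial>step ?x) * indicator good ?x"
        by (intro nn_integral_step_ge[OF sp ge lo f]) auto
      finally show ?thesis using True by simp
    qed auto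
  qed
  finally show ?thesis .
qed

text \<open>Invariant after the clocks 0 to \<open>k\<close>: sites 1 to \<open>k\<close> have a
  density in the box, site \<open>k + 1\<close> has one in its window, and later sites still agree
  with \<open>E\<close>. The function \<open>f\<close> is quantified because the induction peels off
  the last step and applies the hypothesis to the integral of \<open>f\<close> over that
  step.\<close>

lemma iter_ge_fill_window:
  assumes "k < N"
  shows "\<exists>c>0. \<forall>E f. E \<in> space S \<longrightarrow> in_box E \<longrightarrow> f \<in> borel_measurable S \<longrightarrow>
    ennreal c * fill lo hi k (window (Suc k) f) E \<le> (\<integral>\<^sup>+y. f y \<partial>iter (Suc k) E)"
  using assms
proof (induction k)
  case 0
  \<comment> \<open>The right end of the first window; the left bath produces this window from an
    energy \<open>E 1\<close> below \<open>hi\<close>.\<close>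
  let ?u = "real (3 * N - 1) * hi"
  let ?c = "exp (- (?u + 1) / TL) / TL / (hi + ?u + 1)"
  have c: "0 < ?c" using TL hi by (simp add: add_nonneg_pos add_pos_nonneg)
  show ?case
  proof (intro exI[of _ "weight_bound lo * ?c"] conjI allI impI)
    show "0 < weight_bound lo * ?c"
      using weight_bound_pos[OF lo] c by (rule mult_pos_pos)
    fix E and f :: "state \<Rightarrow> ennreal"
    assume E: "E \<in> space S" "in_box E" and f: "f \<in> borel_measurable S"
    have ge: "lo \<le> E i" if "i \<in> {1..N}" for i
      using E(2) that by (auto intro: less_imp_le)
    have good: "E \<in> good"
      using E by (rule box_good)
    have 1: "0 < E 1" "E 1 \<le> hi" "1 \<in> {1..N}"
      using E(2) lo N by (auto intro: less_imp_le dest!: bspec[of _ _ 1])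
    have "hi \<le> ?u"
      using N hi by (auto simp: of_nat_diff algebra_simps intro!: mult_left_mono)
    then have "ennreal ?c * window 1 f E \<le> (\<integral>\<^sup>+y. f y \<partial>jump E 0)"
      using nn_integral_bath_jump_ge[OF f E(1) 1(3) TL 1(1,2), of hi ?u] hi by (simp add: jump_kernel_def)
    then have "ennreal (weight_bound lo) * (ennreal ?c * window 1 f E)
        \<le> ennreal (weight_bound lo) * (\<integral>\<^sup>+y. f y \<partial>jump E 0)"
      by (intro mult_left_mono) auto
    also have "\<dots> \<le> (\<integral>\<^sup>+y. f y \<partial>step E) * indicator good E"
      by (rule nn_integral_step_ge[OF E(1) ge lo f]) auto
    also have "\<dots> = (\<integral>\<^sup>+y. f y \<partial>iter (Suc 0) E)"
      unfolding nn_integral_iter_Suc[OF good f]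
      using measurable_nn_integral_step[OF f] E(1) by (simp add: nn_integral_return)
    finally have le: "ennreal (weight_bound lo) * (ennreal ?c * window 1 f E)
        \<le> (\<integral>\<^sup>+y. f y \<partial>iter (Suc 0) E)" .
    have "ennreal (weight_bound lo * ?c) = ennreal (weight_bound lo) * ennreal ?c"
      using c weight_bound_pos[OF lo] by (intro ennreal_mult less_imp_le)
    then show "ennreal (weight_bound lo * ?c) * fill lo hi 0 (window (Suc 0) f) E
        \<le> (\<integral>\<^sup>+y. f y \<partial>iter (Suc 0) E)"
      using le unfolding fill_0[OF E(1)] One_nat_def by (simp only: mult.assoc)
  qed
next
  case (Suc k)
  obtain c where c: "0 < c" and IH: "\<And>E f. E \<in> space S \<Longrightarrow> in_box E \<Longrightarrow>
      f \<in> borel_measurable S \<Longrightarrow>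
      ennreal c * fill lo hi k (window (Suc k) f) E \<le> (\<integral>\<^sup>+y. f y \<partial>iter (Suc k) E)"
    using Suc.IH[OF Suc_lessD[OF Suc.prems]] by blast
  let ?c = "weight_bound lo / (real (3 * N) * hi)"
  have c': "0 < ?c" using weight_bound_pos[OF lo] hi N by simp
  show ?case
  proof (intro exI[of _ "c * ?c"] conjI allI impI)
    show "0 < c * ?c" using c c' by (rule mult_pos_pos)
    fix E and f :: "state \<Rightarrow> ennreal"
    assume E: "E \<in> space S" "in_box E" and f: "f \<in> borel_measurable S"
    have good: "E \<in> good"
      using E by (rule box_good)
    let ?h = "\<lambda>y. (\<integral>\<^sup>+y'. f y' \<partial>step y) * indicator good y"
    have w: "window (Suc (Suc k)) f \<in> borel_measurable S"
      using Suc.prems by (intro measurable_fill_inner f) auto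
    have "ennreal (c * ?c) * fill lo hi (Suc k) (window (Suc (Suc k)) f) E
        = ennreal c * (ennreal ?c * fill lo hi k
          (\<lambda>x. \<integral>\<^sup>+w. window (Suc (Suc k)) f (x(Suc k := w)) * indicator {lo<..<hi} w \<partial>lborel) E)"
      unfolding fill_Suc[OF Suc_lessD[OF Suc.prems] w] ennreal_mult[OF less_imp_le[OF c] less_imp_le[OF c']]
      by (rule mult.assoc)
    \<comment> \<open>The exchange estimate at clock \<open>Suc k\<close>, used pointwise for the
      states in the box over which \<open>fill\<close> integrates.\<close>
    also have "\<dots> \<le> ennreal c * fill lo hi k (window (Suc k) ?h) E"
      using Suc.prems E(2)
      by (intro mult_left_mono fill_mono measurable_fill_inner[OF w] window_exchange_ge[OF f]) auto
    also have "\<dots> \<le> (\<integral>\<^sup>+y. ?h y \<partial>iter (Suc k) E)"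
      by (rule IH[OF E measurable_nn_integral_step[OF f]])
    also have "\<dots> = (\<integral>\<^sup>+y. f y \<partial>iter (Suc (Suc k)) E)"
      by (rule nn_integral_iter_Suc[OF good f, symmetric])
    finally show "ennreal (c * ?c) * fill lo hi (Suc k) (window (Suc (Suc k)) f) E
        \<le> (\<integral>\<^sup>+y. f y \<partial>iter (Suc (Suc k)) E)" .
  qed
qed

text \<open>After the clocks 0 to \<open>N - 1\<close> only site \<open>N\<close> is outside the
  box. The right bath brings it back, which makes \<open>N + 1\<close> steps in all.\<close>

lemma iter_ge_box:
  "\<exists>c>0. \<forall>E A. E \<in> space S \<longrightarrow> in_box E \<longrightarrow> A \<in> sets S \<longrightarrow>
    ennreal c * emeasure S (A \<inter> ({1..N} \<rightarrow>\<^sub>E {lo<..<hi})) \<le> emeasure (iter (Suc N) E) A"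
proof -
  obtain m where m: "N = Suc m" using N by (cases N) auto
  obtain c where c: "0 < c" and IH: "\<And>E f. E \<in> space S \<Longrightarrow> in_box E \<Longrightarrow>
      f \<in> borel_measurable S \<Longrightarrow>
      ennreal c * fill lo hi m (window (Suc m) f) E \<le> (\<integral>\<^sup>+y. f y \<partial>iter (Suc m) E)"
    using iter_ge_fill_window[of m] unfolding m by blast
  let ?c = "weight_bound lo * (exp (- (hi + 1) / TR) / TR / (real (3 * N) * hi + hi + 1)) * (real N * hi)"
  have c': "0 < ?c" using weight_bound_pos[OF lo] hi N TR by (simp add: add_nonneg_pos)
  show ?thesis
  proof (intro exI[of _ "c * ?c"] conjI allI impI)
    show "0 < c * ?c" using c c' by (rule mult_pos_pos)
    fix E A assume E: "E \<in> space S" "in_box E" and A: "A \<in> sets S"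
    have good: "E \<in> good"
      using E by (rule box_good)
    let ?f = "indicator A :: state \<Rightarrow> ennreal"
    have f: "?f \<in> borel_measurable S" using A by simp
    let ?h = "\<lambda>y. (\<integral>\<^sup>+y'. ?f y' \<partial>step y) * indicator good y"
    have "ennreal (c * ?c) * emeasure S (A \<inter> ({1..N} \<rightarrow>\<^sub>E {lo<..<hi}))
        = ennreal c * (ennreal ?c * fill lo hi (Suc m) ?f E)"
      unfolding fill_N[OF A, of _ _ E, symmetric] ennreal_mult[OF less_imp_le[OF c] less_imp_le[OF c']] m[symmetric]
      by (rule mult.assoc)
    also have "\<dots> = ennreal c * (ennreal ?c * fill lo hi m
          (\<lambda>x. \<integral>\<^sup>+w. ?f (x(N := w)) * indicator {lo<..<hi} w \<partial>lborel) E)"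
      using m by (subst fill_Suc[OF _ f]) auto
    also have "\<dots> \<le> ennreal c * fill lo hi m (window N ?h) E"
      using m N E(2)
      by (intro mult_left_mono fill_mono measurable_fill_inner[OF f] window_bath_ge[OF f]) auto
    also have "\<dots> \<le> (\<integral>\<^sup>+y. ?h y \<partial>iter N E)"
      using IH[OF E measurable_nn_integral_step[OF f]] m by simp
    also have "\<dots> = (\<integral>\<^sup>+y. ?f y \<partial>iter (Suc N) E)"
      by (rule nn_integral_iter_Suc[OF good f, symmetric])
    also have "\<dots> = emeasure (iter (Suc N) E) A"
      using A subprob_iter[OF good] by (intro nn_integral_indicator) blast
    finally show "ennreal (c * ?c) * emeasure S (A \<inter> ({1..N} \<rightarrow>\<^sub>E {lo<..<hi}))
        \<le> emeasure (iter (Suc N) E) A" .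
  qed
qed

end
end

section \<open>Energy bounds on the set C\<close>

lemma C_set_sets: "C_set N \<eta> M0 M1 \<in> sets (state_space N)"
proof -
  have comp: "(\<lambda>E. E i) \<in> borel_measurable (state_space N)" if "1 \<le> i" "i \<le> N" for i
    using that by (intro measurable_state_component measurable_ident_sets) auto
  have V: "V_fun N \<eta> \<in> borel_measurable (state_space N)"
    unfolding V_fun_def[abs_def]
    by (intro borel_measurable_sum powr_real_measurable borel_measurable_const comp) auto
  have W: "W_fun N \<in> borel_measurable (state_space N)"
    unfolding W_fun_def[abs_def] by (intro borel_measurable_sum comp) auto
  show ?thesis
    unfolding C_set_def using V W comp
    by (intro sets.sets_Collect_conj sets.sets_Collect_finite_All borel_measurable_le
        borel_measurable_less) auto
qed

text \<open>For \<open>m = 1\<close> the coefficient is 1 and the inner sum is a single energy; all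
  other terms are nonnegative.\<close>

lemma V_fun_ge:
  assumes "k \<in> {1..N}"
  shows "E k powr (\<eta> - 1) \<le> V_fun N \<eta> E"
proof -
  let ?t = "\<lambda>m k. (\<Sum>j=0..m-1. E (k + j)) powr (a_coef N m * \<eta> - 1)"
  have "E k powr (\<eta> - 1) = ?t 1 k"
    by (simp add: a_coef_def)
  also have "\<dots> \<le> (\<Sum>k=1..N-1+1. ?t 1 k)"
    using assms by (intro member_le_sum) auto
  also have "\<dots> \<le> V_fun N \<eta> E"
    unfolding V_fun_def
    by (rule member_le_sum[of 1 "{1..N}" "\<lambda>m. \<Sum>k=1..N-m+1. ?t m k"])
       (use assms in \<open>auto intro!: sum_nonneg simp del: sum.cl_ivl_Suc\<close>)
  finally show ?thesis .
qed

text \<open>The exponent \<open>\<eta> - 1\<close> is negative, so an upper bound on V keeps each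
  energy away from 0; the upper bound comes from W.\<close>

lemma C_set_bounds:
  assumes E: "E \<in> C_set N \<eta> M0 M1" and i: "i \<in> {1..N}" and \<eta>: "\<eta> < 1" and M0: "0 < M0"
  shows "M0 powr (1 / (\<eta> - 1)) \<le> E i" "E i \<le> M1"
proof -
  have pos: "0 < E j" if "j \<in> {1..N}" for j
    using E that by (auto simp: C_set_def)
  show "M0 powr (1 / (\<eta> - 1)) \<le> E i"
  proof (rule ccontr)
    assume "\<not> ?thesis"
    then have "(M0 powr (1 / (\<eta> - 1))) powr (\<eta> - 1) < E i powr (\<eta> - 1)"
      using pos[OF i] \<eta> by (intro powr_less_mono2_neg) auto
    also have "\<dots> \<le> M0"
      using V_fun_ge[OF i, of E \<eta>] E by (simp add: C_set_def)
    finally show False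
      using \<eta> M0 by (simp add: powr_powr)
  qed
  have "E i \<le> W_fun N E"
    unfolding W_fun_def using i pos by (intro member_le_sum) (auto intro: less_imp_le)
  then show "E i \<le> M1"
    using E by (simp add: C_set_def)
qed

section \<open>From the box to the uniform measure on C\<close>

lemma ennreal_mult_divide_cancel:
  assumes "0 \<le> r" "0 < v"
  shows "ennreal (r * v) * (x / ennreal v) = ennreal r * x"
proof -
  have "ennreal v * (x / ennreal v) = x"
    using assms(2) by (simp add: ennreal_times_divide ennreal_mult_divide_eq mult.commute)
  then show ?thesis
    unfolding ennreal_mult[OF assms(1) less_imp_le[OF assms(2)]] mult.assoc by (rule arg_cong)
qed

theorem theorem6p1:
  fixes N :: nat and TL TR K \<eta> M0 M1 t :: real
  assumes "N \<ge> 1" and "TL > 0" and "TR > 0"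
    and "K > 0" and "K \<ge> TL" and "K \<ge> TR"
    and "0 < \<eta>" and "\<eta> < 1"
    and "M0 > 1" and "M1 > 1"
    and "t > 0"
  shows "\<exists>\<kappa>>0. \<forall>E\<in>C_set N \<eta> M0 M1. \<forall>A\<in>sets (state_space N).
           emeasure (transition N K TL TR t E) A
             \<ge> ennreal \<kappa> * emeasure (uniform_measure (state_space N) (C_set N \<eta> M0 M1)) A"
proof -
  interpret energy_exchange N K TL TR
    using assms by unfold_locales
  let ?C = "C_set N \<eta> M0 M1"
  \<comment> \<open>Half of the lower bound on C, to make the inequality strict, capped by
    \<open>1/2\<close> so that \<open>lo < hi\<close>.\<close>
  define lo where "lo = min (1/2) (M0 powr (1 / (\<eta> - 1)) / 2)"
  define hi where "hi = M1 + 1"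
  have M0pos: "0 < M0 powr (1 / (\<eta> - 1))"
    using assms by simp
  then have lo: "0 < lo" "lo < hi"
    using assms by (auto simp: lo_def hi_def)
  have box: "\<forall>i\<in>{1..N}. lo < E i \<and> E i < hi" if "E \<in> ?C" for E
  proof
    fix i assume i: "i \<in> {1..N}"
    have "0 < M0"
      using assms(9) by linarith
    note bounds = C_set_bounds[OF that i assms(8) this]
    have "lo \<le> M0 powr (1 / (\<eta> - 1)) / 2"
      unfolding lo_def by (rule min.cobounded2)
    with bounds M0pos show "lo < E i \<and> E i < hi"
      unfolding hi_def by linarith
  qed
  have Csp: "?C \<subseteq> space S"
    by (auto simp: C_set_def)
  then have "?C \<subseteq> extensional {1..N}"
    by (auto simp: state_space_def space_PiM PiE_def)
  then have Cbox: "?C \<subseteq> {1..N} \<rightarrow>\<^sub>E {lo<..<hi}"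
    using box unfolding PiE_def Pi_def greaterThanLessThan_iff by blast
  obtain c where c: "0 < c" and iter: "\<And>E A. E \<in> space S \<Longrightarrow> \<forall>i\<in>{1..N}. lo < E i \<and> E i < hi \<Longrightarrow>
      A \<in> sets S \<Longrightarrow> ennreal c * emeasure S (A \<inter> ({1..N} \<rightarrow>\<^sub>E {lo<..<hi})) \<le> emeasure (iter (Suc N) E) A"
    using iter_ge_box[OF lo] by blast
  \<comment> \<open>The probability that the uniformized chain makes exactly \<open>N + 1\<close>
    steps up to time \<open>t\<close>; it is positive for every \<open>t > 0\<close>.\<close>
  let ?q = "pmf (poisson_pmf (unif_rate N K * t)) (Suc N)"
  have q: "0 < ?q"
    using assms(4,11) by (simp add: unif_rate_def)
  have main: "ennreal (?q * c) * emeasure S (?C \<inter> A) \<le> emeasure (transition N K TL TR t E) A"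
    if E: "E \<in> ?C" and A: "A \<in> sets S" for E A
  proof -
    have "emeasure S (?C \<inter> A) \<le> emeasure S (A \<inter> ({1..N} \<rightarrow>\<^sub>E {lo<..<hi}))"
      by (rule emeasure_mono) (use Cbox in blast, rule sets.Int[OF A box_sets])
    then have "ennreal (?q * c) * emeasure S (?C \<inter> A)
        \<le> ennreal ?q * (ennreal c * emeasure S (A \<inter> ({1..N} \<rightarrow>\<^sub>E {lo<..<hi})))"
      unfolding ennreal_mult[OF less_imp_le[OF q] less_imp_le[OF c]] mult.assoc
      by (intro mult_left_mono zero_le)
    also have "\<dots> \<le> ennreal ?q * emeasure (iter (Suc N) E) A"
      using iter[OF subsetD[OF Csp E] box[OF E] A] by (rule mult_left_mono) (rule zero_le)
    also have "\<dots> \<le> emeasure (transition N K TL TR t E) A"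
      by (rule transition_ge[OF box_good[OF lo subsetD[OF Csp E] box[OF E]] A assms(11)])
    finally show ?thesis .
  qed
  let ?m = "emeasure S ?C"
  show ?thesis
  \<comment> \<open>With \<open>M0\<close> and \<open>M1\<close> only assumed to exceed 1, C may be
    empty. If its volume is 0 or infinite, division in \<open>ennreal\<close> makes
    \<open>uniform_measure\<close> vanish on all measurable sets, and any constant works.\<close>
  proof (cases "?m = 0 \<or> ?m = \<infinity>")
    case True
    have "emeasure (uniform_measure S ?C) A = 0" if A: "A \<in> sets S" for A
    proof -
      have "emeasure S (?C \<inter> A) \<le> ?m"
        by (rule emeasure_mono[OF Int_lower1 C_set_sets])
      then show ?thesis
        using True unfolding emeasure_uniform_measure[OF C_set_sets A] by auto
    qed
    then show ?thesis
      by (intro exI[of _ 1]) auto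
  next
    case False
    define v where "v = enn2real ?m"
    have v: "?m = ennreal v" "0 < v"
      using False by (simp_all add: v_def enn2real_positive_iff top.not_eq_extremum zero_less_iff_neq_zero)
    show ?thesis
    \<comment> \<open>The factor \<open>v\<close> cancels the normalization of the uniform measure
      by the volume of C.\<close>
    proof (intro exI[of _ "?q * c * v"] conjI ballI)
      show "0 < ?q * c * v" using q c v by simp
      fix E A assume EA: "E \<in> ?C" "A \<in> sets S"
      have "0 \<le> ?q * c"
        using q c by (intro mult_nonneg_nonneg less_imp_le)
      then show "emeasure (transition N K TL TR t E) A
          \<ge> ennreal (?q * c * v) * emeasure (uniform_measure S ?C) A"
        unfolding emeasure_uniform_measure[OF C_set_sets EA(2)] v(1)
        by (simp only: ennreal_mult_divide_cancel[OF _ v(2)] main[OF EA])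
    qed
  qed
qed

end
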